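(* Let $\mathscr{H}_2$ be a separable real Hilbert space and let $K:\ell^2\to\mathscr{H}_2$ be a linear operator with operator norm $\|K\|\le1$ that possesses the FBI property. Let $u^{\diamond}\in\ell^0$, $u^{\diamond}\neq0$, with $\operatorname{supp}(u^{\diamond})=I$, let $\eta\in\mathscr{H}_2$, and let $g^{\varepsilon}=Ku^{\diamond}+\eta$ be the noisy data with noise-to-signal ratio $$r_{\eta/u}:=\frac{\sup_{i\in\mathbb{Z}}|\langle\eta,Ke_i\rangle|}{\min_{i\in I}|u^{\diamond}_i|}.$$ Put $$\operatorname{COR}_I:=\sup_{i\in I}\sum_{j\in I,\,j\neq i}|\langle Ke_i,Ke_j\rangle|,\qquad \operatorname{COR}_{I^{\complement}}:=\sup_{i\in I^{\complement}}\sum_{j\in I}|\langle Ke_i,Ke_j\rangle| .$$ Assume that $$\operatorname{COR}_I+\operatorname{COR}_{I^{\complement}}<\min_{i\in I}\|Ke_i\|_{\mathscr{H}_2}^2-2\,r_{\eta/u}.$$ Then there exists a regularization parameter $\alpha$ with $$\frac{\min_{i\in I}\|Ke_i\|_{\mathscr{H}_2}^2-\operatorname{COR}_I+\operatorname{COR}_{I^{\complement}}}{\min_{i\in I}\|Ke_i\|_{\mathscr{H}_2}^2-\operatorname{COR}_I-\operatorname{COR}_{I^{\complement}}}\;\sup_{i\in\mathbb{Z}}|\langle\eta,Ke_i\rangle|<\alpha<\Bigl(\min_{i\in I}\|Ke_i\|_{\mathscr{H}_2}^2-\operatorname{COR}_I\Bigr)\min_{i\in I}|u^{\diamond}_i|-\sup_{i\in\mathbb{Z}}|\langle\eta,Ke_i\rangle|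 ,$$ and for every such $\alpha$, every minimizer $u^{\alpha,\varepsilon}\in\operatorname{arg\,min}_{u\in\ell^2}T_\alpha(u)$ satisfies $\operatorname{supp}(u^{\alpha,\varepsilon})=\operatorname{supp}(u^{\diamond})=I$.
   Context: $\ell^2=\ell^2(\mathbb{Z},\mathbb{R})$ with standard basis $\{e_j\}_{j\in\mathbb{Z}}$; $\ell^0$ is the vector space of real sequences indexed by $\mathbb{Z}$ with only finitely many nonzero entries; $\operatorname{supp}(u)=\{i\in\mathbb{Z}: u_i\neq 0\}$; $I^{\complement}=\mathbb{Z}\setminus I$. FBI (finite basis injectivity) property of $K$: for every finite $J\subset\mathbb{Z}$, the restriction of $K$ to $\operatorname{span}\{e_i: i\in J\}$ is injective. The $\ell^1$-penalized Tikhonov functional with $\alpha>0$ is $T_\alpha(u)=\tfrac12\|Ku-g^{\varepsilon}\|_{\mathscr{H}_2}^2+\alpha\|u\|_{\ell^1}$ for $u\in\ell^2$, where $\|u\|_{\ell^1}=\infty$ if $u\in\ell^2\setminus\ell^1$. *)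

theory Defs
  imports "HOL-Analysis.Analysis"
begin

section \<open>The Hilbert space of square-summable real sequences indexed by the integers\<close>

typedef ell2 = "{x :: int \<Rightarrow> real. (\<lambda>i. (x i)\<^sup>2) summable_on UNIV}"
  morphisms coord Abs_ell2
  by (rule exI[of _ "\<lambda>_. 0"]) simp

setup_lifting type_definition_ell2

lemma summable_on_mult_of_squares:
  fixes x y :: "int \<Rightarrow> real"
  assumes x: "(\<lambda>i. (x i)\<^sup>2) summable_on UNIV" and y: "(\<lambda>i. (y i)\<^sup>2) summable_on UNIV"
  shows "(\<lambda>i. x i * y i) summable_on UNIV"
proof -
  have s: "(\<lambda>i. (x i)\<^sup>2 + (y i)\<^sup>2) summable_on UNIV"
    by (rule summable_on_add[OF x y])
  have "norm (x i * y i) \<le> (x i)\<^sup>2 + (y i)\<^sup>2" for i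
  proof -
    have "2 * (\<bar>x i\<bar> * \<bar>y i\<bar>) \<le> (x i)\<^sup>2 + (y i)\<^sup>2"
      using sum_squares_bound[of "\<bar>x i\<bar>" "\<bar>y i\<bar>"] by (simp add: mult.assoc)
    moreover have "0 \<le> \<bar>x i\<bar> * \<bar>y i\<bar>" by simp
    ultimately have "\<bar>x i\<bar> * \<bar>y i\<bar> \<le> (x i)\<^sup>2 + (y i)\<^sup>2" by linarith
    then show ?thesis by (simp add: abs_mult)
  qed
  then have "(\<lambda>i. norm (x i * y i)) summable_on UNIV"
    by (intro summable_on_comparison_test[OF s]) auto
  then show ?thesis by (rule abs_summable_summable)
qed

lemma summable_on_square_add:
  fixes x y :: "int \<Rightarrow> real"
  assumes x: "(\<lambda>i. (x i)\<^sup>2) summable_on UNIV" and y: "(\<lambda>i. (y i)\<^sup>2) summable_on UNIV"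
  shows "(\<lambda>i. (x i + y i)\<^sup>2) summable_on UNIV"
proof -
  have "(\<lambda>i. ((x i)\<^sup>2 + (y i)\<^sup>2) + 2 * (x i * y i)) summable_on UNIV"
    by (intro summable_on_add x y summable_on_cmult_right summable_on_mult_of_squares)
  then show ?thesis by (simp add: power2_sum algebra_simps)
qed

lemma summable_on_square_scale:
  fixes x :: "int \<Rightarrow> real"
  assumes "(\<lambda>i. (x i)\<^sup>2) summable_on UNIV"
  shows "(\<lambda>i. (c * x i)\<^sup>2) summable_on UNIV"
  using summable_on_cmult_right[OF assms, of "c\<^sup>2"] by (simp add: power_mult_distrib)

instantiation ell2 :: real_inner
begin

lift_definition zero_ell2 :: ell2 is "\<lambda>_. 0"
  by simp

lift_definition plus_ell2 :: "ell2 \<Rightarrow> ell2 \<Rightarrow> ell2" is "\<lambda>x y i. x i + y i"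
  by (rule summable_on_square_add)

lift_definition uminus_ell2 :: "ell2 \<Rightarrow> ell2" is "\<lambda>x i. - x i"
  by simp

lift_definition minus_ell2 :: "ell2 \<Rightarrow> ell2 \<Rightarrow> ell2" is "\<lambda>x y i. x i - y i"
  subgoal for x y
    using summable_on_square_add[of x "\<lambda>i. - y i"] by simp
  done

lift_definition scaleR_ell2 :: "real \<Rightarrow> ell2 \<Rightarrow> ell2" is "\<lambda>c x i. c * x i"
  by (rule summable_on_square_scale)

lift_definition inner_ell2 :: "ell2 \<Rightarrow> ell2 \<Rightarrow> real" is "\<lambda>x y. \<Sum>\<^sub>\<infinity>i. x i * y i" .

definition norm_ell2 :: "ell2 \<Rightarrow> real" where
  "norm_ell2 x = sqrt (inner x x)"

definition sgn_ell2 :: "ell2 \<Rightarrow> ell2" where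
  "sgn_ell2 x = inverse (norm x) *\<^sub>R x"

definition dist_ell2 :: "ell2 \<Rightarrow> ell2 \<Rightarrow> real" where
  "dist_ell2 x y = norm (x - y)"

definition uniformity_ell2 :: "(ell2 \<times> ell2) filter" where
  [code del]: "uniformity_ell2 = (INF e\<in>{0<..}. principal {(x, y). dist x y < e})"

definition open_ell2 :: "ell2 set \<Rightarrow> bool" where
  [code del]: "open_ell2 U \<longleftrightarrow> (\<forall>x\<in>U. eventually (\<lambda>(x', y). x' = x \<longrightarrow> y \<in> U) uniformity)"

instance
proof
  fix x y z :: ell2 and a b r :: real
  show "x + y + z = x + (y + z)" by transfer (simp add: add.assoc)
  show "x + y = y + x" by transfer (simp add: add.commute)
  show "0 + x = x" by transfer simp
  show "- x + x = 0" by transfer simp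
  show "x - y = x + - y" by transfer simp
  show "a *\<^sub>R (x + y) = a *\<^sub>R x + a *\<^sub>R y" by transfer (simp add: algebra_simps)
  show "(a + b) *\<^sub>R x = a *\<^sub>R x + b *\<^sub>R x" by transfer (simp add: algebra_simps)
  show "a *\<^sub>R b *\<^sub>R x = (a * b) *\<^sub>R x" by transfer (simp add: algebra_simps)
  show "1 *\<^sub>R x = x" by transfer simp
  show "sgn x = inverse (norm x) *\<^sub>R x" by (rule sgn_ell2_def)
  show "dist x y = norm (x - y)" by (rule dist_ell2_def)
  show "uniformity = (INF e\<in>{0<..}. principal {(x, y :: ell2). dist x y < e})"
    by (rule uniformity_ell2_def)
  show "open U \<longleftrightarrow> (\<forall>x\<in>U. eventually (\<lambda>(x', y). x' = x \<longrightarrow> y \<in> U) uniformity)" for U :: "ell2 set"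
    by (rule open_ell2_def)
  show "inner x y = inner y x" by transfer (simp add: mult.commute)
  show "inner (x + y) z = inner x z + inner y z"
    by transfer (simp add: distrib_right infsum_add summable_on_mult_of_squares)
  show "inner (r *\<^sub>R x) y = r * inner x y"
    by transfer (simp add: mult.assoc infsum_cmult_right summable_on_mult_of_squares)
  show "0 \<le> inner x x" by transfer (simp add: infsum_nonneg)
  show "inner x x = 0 \<longleftrightarrow> x = 0"
  proof transfer
    fix f :: "int \<Rightarrow> real"
    assume s: "(\<lambda>i. (f i)\<^sup>2) summable_on UNIV"
    show "(\<Sum>\<^sub>\<infinity>i. f i * f i) = 0 \<longleftrightarrow> f = (\<lambda>_. 0)"
    proof
      assume "(\<Sum>\<^sub>\<infinity>i. f i * f i) = 0"
      then have "(f i)\<^sup>2 = 0" for i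
        by (intro nonneg_infsum_le_0D[where A = UNIV and f = "\<lambda>i. (f i)\<^sup>2"])
          (use s in \<open>auto simp: power2_eq_square\<close>)
      then show "f = (\<lambda>_. 0)" by auto
    qed simp
  qed
  show "norm x = sqrt (inner x x)" by (rule norm_ell2_def)
qed

end

lift_definition unit_seq :: "int \<Rightarrow> ell2" is "\<lambda>j i. if i = j then 1 else 0"
  subgoal for j
  proof -
    have "(\<lambda>i. (if i = j then 1 else 0 :: real)\<^sup>2) summable_on {j}"
      by simp
    then show ?thesis
      by (rule summable_on_cong_neutral[THEN iffD1, rotated -1]) auto
  qed
  done

definition supp :: "ell2 \<Rightarrow> int set" where
  "supp u = {i. coord u i \<noteq> 0}"

text \<open>Every finitely supported sequence is square-summable, so \<open>ell0\<close> is a set of \<open>ell2\<close> elements.\<close>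

definition ell0 :: "ell2 set" where
  "ell0 = {u. finite (supp u)}"

definition l1_norm :: "ell2 \<Rightarrow> ereal" where
  "l1_norm u = (if (\<lambda>i. \<bar>coord u i\<bar>) summable_on UNIV
                then ereal (\<Sum>\<^sub>\<infinity>i. \<bar>coord u i\<bar>) else \<infinity>)"


section \<open>Operators on sequences\<close>

definition FBI :: "(ell2 \<Rightarrow> 'h::real_vector) \<Rightarrow> bool" where
  "FBI K \<longleftrightarrow> (\<forall>J. finite J \<longrightarrow> inj_on K (span (unit_seq ` J)))"

definition tikhonov :: "(ell2 \<Rightarrow> 'h::real_normed_vector) \<Rightarrow> 'h \<Rightarrow> real \<Rightarrow> ell2 \<Rightarrow> ereal" where
  "tikhonov K g \<alpha> u = ereal (1 / 2 * (norm (K u - g))\<^sup>2) + ereal \<alpha> * l1_norm u"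

text \<open>
  The suprema below are taken in the reals. The index sets are nonempty and, for a bounded
  operator \<open>K\<close> and a finite nonempty \<open>I\<close>, all the families involved are bounded, so these are the
  ordinary suprema. Likewise the minima are over finite nonempty sets.
\<close>

definition COR_in :: "(ell2 \<Rightarrow> 'h::real_inner) \<Rightarrow> int set \<Rightarrow> real" where
  "COR_in K I = (SUP i\<in>I. \<Sum>j\<in>I - {i}. \<bar>inner (K (unit_seq i)) (K (unit_seq j))\<bar>)"

definition COR_out :: "(ell2 \<Rightarrow> 'h::real_inner) \<Rightarrow> int set \<Rightarrow> real" where
  "COR_out K I = (SUP i\<in>- I. \<Sum>j\<in>I. \<bar>inner (K (unit_seq i)) (K (unit_seq j))\<bar>)"

definition min_col :: "(ell2 \<Rightarrow> 'h::real_inner) \<Rightarrow> int set \<Rightarrow> real" where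
  "min_col K I = (MIN i\<in>I. (norm (K (unit_seq i)))\<^sup>2)"

definition min_entry :: "ell2 \<Rightarrow> int set \<Rightarrow> real" where
  "min_entry u I = (MIN i\<in>I. \<bar>coord u i\<bar>)"

definition sup_noise :: "(ell2 \<Rightarrow> 'h::real_inner) \<Rightarrow> 'h \<Rightarrow> real" where
  "sup_noise K \<eta> = (SUP i. \<bar>inner \<eta> (K (unit_seq i))\<bar>)"

definition noise_to_signal :: "(ell2 \<Rightarrow> 'h::real_inner) \<Rightarrow> 'h \<Rightarrow> ell2 \<Rightarrow> int set \<Rightarrow> real" where
  "noise_to_signal K \<eta> u I = sup_noise K \<eta> / min_entry u I"

definition admissible_parameter ::
    "(ell2 \<Rightarrow> 'h::real_inner) \<Rightarrow> 'h \<Rightarrow> ell2 \<Rightarrow> int set \<Rightarrow> real \<Rightarrow> bool" where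
  "admissible_parameter K \<eta> u I \<alpha> \<longleftrightarrow>
     (min_col K I - COR_in K I + COR_out K I) / (min_col K I - COR_in K I - COR_out K I)
       * sup_noise K \<eta> < \<alpha> \<and>
     \<alpha> < (min_col K I - COR_in K I) * min_entry u I - sup_noise K \<eta>"

end

theory Submission
  imports Defs
begin

text \<open>
  On \<open>I\<close> the Gram matrix \<open>inner (K e\<^sub>i) (K e\<^sub>j)\<close> is strictly diagonally dominant with margin
  \<open>M = min_col K I - COR_in K I\<close>, so a vector \<open>h\<close> supported in \<open>I\<close> whose
  correlations \<open>inner (K e\<^sub>i) (K h)\<close>, \<open>i \<in> I\<close>, are bounded by \<open>c\<close> has entries of size at
  most \<open>c / M\<close> (\<open>gram_diagonal_dominance\<close>).

  Instead of starting from a minimizer, the proof guesses it. If the minimizer has the support and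
  the signs of \<open>u0\<close>, its first-order conditions on \<open>I\<close> are a linear Gram system for
  \<open>h = v - u0\<close> with right-hand side \<open>inner \<eta> (K e\<^sub>i) - \<alpha> sgn (u0 i)\<close>; diagonal dominance
  makes it solvable (\<open>gram_system_solvable\<close>). With \<open>s = sup_noise K \<eta>\<close> the right-hand side is
  bounded by \<open>\<alpha> + s\<close>, so the entries of \<open>h\<close> are at most \<open>(\<alpha> + s) / M\<close>. The upper bound
  on \<open>\<alpha>\<close> says exactly that this lies below every \<open>\<bar>u0 i\<bar>\<close>, \<open>i \<in> I\<close>, so that
  \<open>v = u0 + h\<close> really has the signs of \<open>u0\<close>. For \<open>i\<close> outside \<open>I\<close> the residual correlation
  is at most \<open>COR_out K I * (\<alpha> + s) / M + s\<close>, and the lower bound on \<open>\<alpha>\<close> says exactly that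
  this is below \<open>\<alpha>\<close>.

  Thus the residual correlations of \<open>v\<close> form a dual certificate that is strict off \<open>I\<close>. By
  convexity, an element with a value of the functional no larger than that of \<open>v\<close> is supported in
  \<open>I\<close> and has the same image under \<open>K\<close> (\<open>strict_certificate_determines_minimizers\<close>). As the
  Gram matrix on \<open>I\<close> is injective, every minimizer equals \<open>v\<close>, whose support is \<open>I\<close>.

  The interval for \<open>\<alpha>\<close> is nonempty because, with \<open>w\<close> the least entry of \<open>u0\<close> on \<open>I\<close> in
  absolute value, clearing the denominator \<open>M - COR_out K I\<close> turns the comparison of its ends into
  \<open>2 s M < M w (M - COR_out K I)\<close>, that is, into the hypothesis on the noise-to-signal ratio
  multiplied by \<open>M w\<close>.
\<close>

section \<open>Coordinates and the standard basis\<close>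

lemma coord_zero [simp]: "coord 0 i = 0"
  by transfer simp

lemma coord_add [simp]: "coord (x + y) i = coord x i + coord y i"
  by transfer simp

lemma coord_diff [simp]: "coord (x - y) i = coord x i - coord y i"
  by transfer simp

lemma coord_scaleR [simp]: "coord (c *\<^sub>R x) i = c * coord x i"
  by transfer simp

lemma coord_sum [simp]: "coord (\<Sum>j\<in>A. f j) i = (\<Sum>j\<in>A. coord (f j) i)"
  by (induction A rule: infinite_finite_induct) auto

lemma coord_unit_seq: "coord (unit_seq j) i = (if i = j then 1 else 0)"
  by transfer simp

lemma ell2_eqI: "(\<And>i. coord x i = coord y i) \<Longrightarrow> x = y"
  by (simp add: coord_inject[symmetric] fun_eq_iff)

lemma inner_unit_seq [simp]: "inner (unit_seq i) x = coord x i"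
proof transfer
  fix i and x :: "int \<Rightarrow> real"
  have "((\<lambda>k. (if k = i then 1 else 0) * x k) has_sum x i) UNIV"
    by (rule has_sum_finite_neutralI[where B = "{i}"]) auto
  then show "(\<Sum>\<^sub>\<infinity>k. (if k = i then 1 else 0) * x k) = x i"
    by (rule infsumI)
qed

lemma norm_unit_seq [simp]: "norm (unit_seq i) = 1"
  by (simp add: norm_eq_sqrt_inner coord_unit_seq)

lemma finite_support_expansion:
  assumes "finite I" and "supp x \<subseteq> I"
  shows "x = (\<Sum>i\<in>I. coord x i *\<^sub>R unit_seq i)"
proof (rule ell2_eqI)
  fix k
  have "coord x k = 0" if "k \<notin> I"
    using that assms(2) by (auto simp: supp_def)
  then show "coord x k = coord (\<Sum>i\<in>I. coord x i *\<^sub>R unit_seq i) k"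
    using assms(1) by (simp add: coord_unit_seq if_distrib[of "\<lambda>t. _ * t"] cong: if_cong)
qed

lemma span_unit_seq:
  assumes "finite I"
  shows "span (unit_seq ` I) = {x. supp x \<subseteq> I}"
proof (intro equalityI subsetI)
  fix x assume "x \<in> span (unit_seq ` I)"
  then have "\<forall>k. k \<notin> I \<longrightarrow> coord x k = 0"
    by (induction rule: span_induct_alt) (auto simp: coord_unit_seq split: if_splits)
  then show "x \<in> {x. supp x \<subseteq> I}"
    by (auto simp: supp_def)
next
  fix x assume "x \<in> {x. supp x \<subseteq> I}"
  then have "x = (\<Sum>i\<in>I. coord x i *\<^sub>R unit_seq i)"
    using finite_support_expansion[OF assms] by simp
  also have "\<dots> \<in> span (unit_seq ` I)"
    by (intro span_sum span_scale span_base) auto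
  finally show "x \<in> span (unit_seq ` I)" .
qed

lemma independent_unit_seq: "independent (unit_seq ` I)"
proof (rule pairwise_orthogonal_independent)
  show "pairwise orthogonal (unit_seq ` I)"
    by (auto simp: pairwise_def orthogonal_def coord_unit_seq)
  show "0 \<notin> unit_seq ` I"
    by (metis imageE norm_unit_seq norm_zero zero_neq_one)
qed

text \<open>Pythagoras: the truncation of \<open>x\<close> to \<open>F\<close> is its orthogonal projection.\<close>

lemma norm_minus_partial_sum:
  assumes "finite F"
  shows "(norm (x - (\<Sum>i\<in>F. coord x i *\<^sub>R unit_seq i)))\<^sup>2 = (norm x)\<^sup>2 - (\<Sum>i\<in>F. (coord x i)\<^sup>2)"
proof -
  define y where "y = (\<Sum>i\<in>F. coord x i *\<^sub>R unit_seq i)"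
  have xy: "inner y x = (\<Sum>i\<in>F. (coord x i)\<^sup>2)"
    by (simp add: y_def inner_sum_left power2_eq_square)
  have "coord y i = coord x i" if "i \<in> F" for i
    using assms that by (simp add: y_def coord_unit_seq if_distrib[of "\<lambda>t. _ * t"] cong: if_cong)
  then have yy: "inner y y = (\<Sum>i\<in>F. (coord x i)\<^sup>2)"
    by (subst (1) y_def) (simp add: inner_sum_left power2_eq_square)
  show ?thesis
    unfolding y_def[symmetric]
    by (simp add: power2_norm_eq_inner inner_diff_left inner_diff_right inner_commute[of x y] xy yy)
qed

text \<open>
  Convergence in norm, not merely coordinatewise: this is what allows a bounded operator to be applied
  term by term. The squared error of a partial sum is a tail of the convergent series for
  \<open>(norm x)\<^sup>2\<close>.
\<close>

lemma has_sum_unit_seq: "((\<lambda>i. coord x i *\<^sub>R unit_seq i) has_sum x) UNIV"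
proof -
  have "((\<lambda>i. (coord x i)\<^sup>2) has_sum (norm x)\<^sup>2) UNIV"
    unfolding power2_norm_eq_inner
    by transfer (simp add: power2_eq_square[symmetric])
  then have "((\<lambda>F. \<Sum>i\<in>F. (coord x i)\<^sup>2) \<longlongrightarrow> (norm x)\<^sup>2) (finite_subsets_at_top UNIV)"
    by (simp add: has_sum_def)
  then have "((\<lambda>F. sqrt ((norm x)\<^sup>2 - (\<Sum>i\<in>F. (coord x i)\<^sup>2))) \<longlongrightarrow> sqrt ((norm x)\<^sup>2 - (norm x)\<^sup>2))
      (finite_subsets_at_top UNIV)"
    by (intro tendsto_intros)
  then have "((\<lambda>F. sqrt ((norm x)\<^sup>2 - (\<Sum>i\<in>F. (coord x i)\<^sup>2))) \<longlongrightarrow> 0) (finite_subsets_at_top UNIV)"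
    by simp
  moreover have "\<forall>\<^sub>F F in finite_subsets_at_top UNIV.
      sqrt ((norm x)\<^sup>2 - (\<Sum>i\<in>F. (coord x i)\<^sup>2)) = dist (\<Sum>i\<in>F. coord x i *\<^sub>R unit_seq i) x"
    by (rule eventually_finite_subsets_at_top_weakI)
      (simp add: norm_minus_partial_sum[symmetric] dist_norm norm_minus_commute)
  ultimately have "((\<lambda>F. dist (\<Sum>i\<in>F. coord x i *\<^sub>R unit_seq i) x) \<longlongrightarrow> 0) (finite_subsets_at_top UNIV)"
    by (rule Lim_transform_eventually)
  then show ?thesis
    unfolding has_sum_def by (subst tendsto_dist_iff)
qed

section \<open>Diagonal dominance of the Gram matrix\<close>

lemma COR_in_upper:
  assumes "finite I" and "i \<in> I"
  shows "(\<Sum>j\<in>I - {i}. \<bar>inner (K (unit_seq i)) (K (unit_seq j))\<bar>) \<le> COR_in K I"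
  unfolding COR_in_def by (rule cSUP_upper) (use assms in auto)

lemma norm_column_le:
  assumes "bounded_linear K"
  shows "norm (K (unit_seq i)) \<le> onorm K"
  using onorm[OF assms, of "unit_seq i"] by simp

text \<open>
  The complement of \<open>I\<close> is infinite, so the supremum is a genuine bound only because the columns
  of a bounded operator are uniformly bounded.
\<close>

lemma COR_out_upper:
  assumes "bounded_linear K" and "i \<notin> I"
  shows "(\<Sum>j\<in>I. \<bar>inner (K (unit_seq i)) (K (unit_seq j))\<bar>) \<le> COR_out K I"
  unfolding COR_out_def
proof (rule cSUP_upper)
  have "\<bar>inner (K (unit_seq k)) (K (unit_seq j))\<bar> \<le> onorm K * onorm K" for k j
    using Cauchy_Schwarz_ineq2[of "K (unit_seq k)" "K (unit_seq j)"]
      mult_mono'[OF norm_column_le[OF assms(1), of k] norm_column_le[OF assms(1), of j]]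
    by simp
  then show "bdd_above ((\<lambda>i. \<Sum>j\<in>I. \<bar>inner (K (unit_seq i)) (K (unit_seq j))\<bar>) ` (- I))"
    by (intro bdd_aboveI2[where M = "\<Sum>j\<in>I. onorm K * onorm K"] sum_mono)
qed (use assms in auto)

lemma COR_out_nonneg:
  assumes "bounded_linear K" and "finite I"
  shows "0 \<le> COR_out K I"
proof -
  obtain i where "i \<notin> I" using assms(2) ex_new_if_finite infinite_UNIV_int by blast
  have "0 \<le> (\<Sum>j\<in>I. \<bar>inner (K (unit_seq i)) (K (unit_seq j))\<bar>)"
    by (rule sum_nonneg) simp
  also have "\<dots> \<le> COR_out K I" by (rule COR_out_upper[OF assms(1) \<open>i \<notin> I\<close>])
  finally show ?thesis .
qed

lemma sup_noise_upper:
  assumes "bounded_linear K"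
  shows "\<bar>inner \<eta> (K (unit_seq i))\<bar> \<le> sup_noise K \<eta>"
  unfolding sup_noise_def
proof (rule cSUP_upper)
  have "\<bar>inner \<eta> (K (unit_seq k))\<bar> \<le> norm \<eta> * onorm K" for k
    using Cauchy_Schwarz_ineq2[of \<eta> "K (unit_seq k)"]
      mult_left_mono[OF norm_column_le[OF assms, of k], of "norm \<eta>"] by simp
  then show "bdd_above (range (\<lambda>i. \<bar>inner \<eta> (K (unit_seq i))\<bar>))"
    by (rule bdd_aboveI2)
qed simp

lemma inner_column_finite_support:
  assumes "bounded_linear K" and "finite I" and "supp h \<subseteq> I"
  shows "inner z (K h) = (\<Sum>j\<in>I. coord h j * inner z (K (unit_seq j)))"
proof -
  interpret bounded_linear K by fact
  show ?thesis
    by (subst finite_support_expansion[OF assms(2,3)]) (simp add: sum scaleR inner_sum_right)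
qed

text \<open>
  In the row of an entry of \<open>h\<close> of largest modulus, the off-diagonal terms
  contribute at most \<open>COR_in K I\<close> times that modulus, which leaves the stated margin for the
  diagonal term.
\<close>

lemma gram_diagonal_dominance:
  assumes K: "bounded_linear K" and I: "finite I" and h: "supp h \<subseteq> I"
    and dom: "COR_in K I \<le> min_col K I"
    and c: "\<And>i. i \<in> I \<Longrightarrow> \<bar>inner (K (unit_seq i)) (K h)\<bar> \<le> c"
    and i: "i \<in> I"
  shows "(min_col K I - COR_in K I) * \<bar>coord h i\<bar> \<le> c"
proof -
  have "Max ((\<lambda>k. \<bar>coord h k\<bar>) ` I) \<in> (\<lambda>k. \<bar>coord h k\<bar>) ` I"
    using I i by (intro Max_in) auto
  then obtain k where k: "k \<in> I" and "\<bar>coord h k\<bar> = Max ((\<lambda>k. \<bar>coord h k\<bar>) ` I)"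
    by auto
  then have kmax: "\<bar>coord h j\<bar> \<le> \<bar>coord h k\<bar>" if "j \<in> I" for j
    using I that by simp
  define G where "G = (\<lambda>j. inner (K (unit_seq k)) (K (unit_seq j)))"
  have "inner (K (unit_seq k)) (K h) = coord h k * G k + (\<Sum>j\<in>I - {k}. coord h j * G j)"
    using inner_column_finite_support[OF K I h] k I by (simp add: G_def sum.remove)
  moreover have "\<bar>\<Sum>j\<in>I - {k}. coord h j * G j\<bar> \<le> COR_in K I * \<bar>coord h k\<bar>"
  proof -
    have "\<bar>\<Sum>j\<in>I - {k}. coord h j * G j\<bar> \<le> (\<Sum>j\<in>I - {k}. \<bar>coord h j * G j\<bar>)"
      by (rule sum_abs)
    also have "\<dots> \<le> (\<Sum>j\<in>I - {k}. \<bar>coord h k\<bar> * \<bar>G j\<bar>)"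
      by (rule sum_mono) (auto simp: abs_mult intro!: mult_right_mono kmax)
    also have "\<dots> = (\<Sum>j\<in>I - {k}. \<bar>G j\<bar>) * \<bar>coord h k\<bar>"
      by (simp add: sum_distrib_left mult.commute)
    also have "\<dots> \<le> COR_in K I * \<bar>coord h k\<bar>"
      unfolding G_def by (intro mult_right_mono COR_in_upper[OF I k]) simp
    finally show ?thesis .
  qed
  moreover have "min_col K I * \<bar>coord h k\<bar> \<le> \<bar>coord h k * G k\<bar>"
  proof -
    have "min_col K I \<le> G k"
      unfolding min_col_def G_def power2_norm_eq_inner[symmetric]
      by (rule Min_le) (use I k in auto)
    moreover have "0 \<le> G k" by (simp add: G_def)
    ultimately show ?thesis
      by (simp add: abs_mult mult.commute[of "\<bar>coord h k\<bar>"] mult_right_mono)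
  qed
  ultimately have "(min_col K I - COR_in K I) * \<bar>coord h k\<bar> \<le> c"
    using c[OF k] by (simp add: left_diff_distrib)
  moreover have "(min_col K I - COR_in K I) * \<bar>coord h i\<bar> \<le> (min_col K I - COR_in K I) * \<bar>coord h k\<bar>"
    using kmax[OF i] dom by (intro mult_left_mono) auto
  ultimately show ?thesis by linarith
qed

lemma gram_kernel_trivial:
  assumes "bounded_linear K" and "finite I" and "supp h \<subseteq> I"
    and dom: "COR_in K I < min_col K I"
    and "\<And>i. i \<in> I \<Longrightarrow> inner (K (unit_seq i)) (K h) = 0"
  shows "h = 0"
proof (rule ell2_eqI)
  fix i
  have "(min_col K I - COR_in K I) * \<bar>coord h i\<bar> \<le> 0" if "i \<in> I"
    by (rule gram_diagonal_dominance[OF assms(1-3) _ _ that]) (use assms in auto)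
  then show "coord h i = coord 0 i"
    using dom assms(3) by (cases "i \<in> I") (auto simp: mult_le_0_iff supp_def)
qed

text \<open>
  The image of the basis is independent and as large as the basis. A vector of the span missed by
  it could be adjoined to give an independent set with more elements than a spanning set.
\<close>

lemma linear_inj_on_imp_surj_on_finite_span:
  fixes f :: "'a::real_vector \<Rightarrow> 'a"
  assumes "linear f" and B: "finite B" "independent B"
    and into: "f ` B \<subseteq> span B" and inj: "inj_on f (span B)"
  shows "f ` span B = span B"
proof -
  have ind: "independent (f ` B)"
    using linear_independent_injective_image[OF assms(1) B(2) inj] .
  have card: "card (f ` B) = card B"
    by (intro card_image inj_on_subset[OF inj] span_superset)
  have "x \<in> span (f ` B)" if x: "x \<in> span B" for x
  proof (rule ccontr)
    assume nx: "x \<notin> span (f ` B)"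
    have "independent (insert x (f ` B))"
      using ind nx by (simp add: independent_insert)
    moreover have "insert x (f ` B) \<subseteq> span B"
      using into x by simp
    ultimately have "card (insert x (f ` B)) \<le> card B"
      using independent_span_bound[OF B(1)] by simp
    moreover have "x \<notin> f ` B" using nx by (auto intro: span_base)
    ultimately show False using card B(1) by simp
  qed
  moreover have "span (f ` B) \<subseteq> span B"
    by (rule span_minimal[OF into subspace_span])
  ultimately show ?thesis
    using linear_span_image[OF assms(1), of B] by auto
qed

text \<open>
  The Gram matrix is turned into an endomorphism of the span of the basis vectors in \<open>I\<close>; its
  trivial kernel makes it surjective.
\<close>

lemma gram_system_solvable:
  fixes c :: "int \<Rightarrow> real"
  assumes K: "bounded_linear K" and I: "finite I" and dom: "COR_in K I < min_col K I"
  obtains h where "supp h \<subseteq> I" and "\<And>i. i \<in> I \<Longrightarrow> inner (K (unit_seq i)) (K h) = c i"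
proof -
  interpret bounded_linear K by fact
  define L where "L h = (\<Sum>i\<in>I. inner (K (unit_seq i)) (K h) *\<^sub>R unit_seq i)" for h
  have coord_L: "coord (L h) i = inner (K (unit_seq i)) (K h)" if "i \<in> I" for h i
    using I that by (simp add: L_def coord_unit_seq if_distrib[of "\<lambda>t. _ * t"] cong: if_cong)
  have lin: "linear L"
    by (rule linearI)
      (simp_all add: L_def add scaleR inner_add_right scaleR_add_left sum.distrib scaleR_sum_right)
  have L_in: "L h \<in> span (unit_seq ` I)" for h
    unfolding L_def by (intro span_sum span_scale span_base) auto
  have "inj_on L (span (unit_seq ` I))"
    unfolding linear_inj_on_iff_eq_0[OF lin subspace_span]
    using gram_kernel_trivial[OF K I _ dom] coord_L
    by (metis coord_zero mem_Collect_eq span_unit_seq[OF I])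
  then have surj: "L ` span (unit_seq ` I) = span (unit_seq ` I)"
    using L_in I by (intro linear_inj_on_imp_surj_on_finite_span lin independent_unit_seq) auto
  define r where "r = (\<Sum>i\<in>I. c i *\<^sub>R unit_seq i)"
  have "r \<in> L ` span (unit_seq ` I)"
    unfolding surj r_def by (intro span_sum span_scale span_base) auto
  then obtain h where h: "h \<in> span (unit_seq ` I)" and Lh: "L h = r"
    by auto
  show thesis
  proof
    show "supp h \<subseteq> I" using h by (simp add: span_unit_seq[OF I])
    show "inner (K (unit_seq i)) (K h) = c i" if "i \<in> I" for i
      using coord_L[OF that, of h] I that
      by (simp add: Lh r_def coord_unit_seq if_distrib[of "\<lambda>t. _ * t"] cong: if_cong)
  qed
qed

section \<open>Strict dual certificates for the Tikhonov functional\<close>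

lemma has_sum_inner_operator:
  assumes "bounded_linear K"
  shows "((\<lambda>i. coord x i * inner z (K (unit_seq i))) has_sum inner z (K x)) UNIV"
proof -
  interpret bounded_linear K by fact
  have "((\<lambda>i. inner z (K (coord x i *\<^sub>R unit_seq i))) has_sum inner z (K x)) UNIV"
    by (rule has_sum_bounded_linear[OF _ has_sum_unit_seq])
      (rule bounded_linear_inner_right_comp[OF assms])
  then show ?thesis by (simp add: scaleR)
qed

text \<open>
  Expanding the square around \<open>v\<close>, the difference of the two functional values is half the
  square of \<open>norm (K u - K v)\<close> plus a series of terms \<open>d i\<close>, each nonnegative: on \<open>I\<close> by the
  subgradient inequality for the absolute value, off \<open>I\<close> because
  \<open>d i \<ge> (\<alpha> - \<bar>p i\<bar>) * \<bar>coord u i\<bar>\<close>, where \<open>p i\<close> is the residual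
  correlation. If the value at \<open>u\<close> is not larger, all of these vanish, and strictness of the
  certificate forces \<open>coord u i = 0\<close> off \<open>I\<close>.
\<close>

lemma strict_certificate_determines_minimizers:
  assumes K: "bounded_linear K" and I: "finite I" and v: "supp v \<subseteq> I" and \<alpha>: "0 < \<alpha>"
    and on_I: "\<And>i. i \<in> I \<Longrightarrow> inner (K v - g) (K (unit_seq i)) = - \<alpha> * sgn (coord v i)"
    and nz: "\<And>i. i \<in> I \<Longrightarrow> coord v i \<noteq> 0"
    and off_I: "\<And>i. i \<notin> I \<Longrightarrow> \<bar>inner (K v - g) (K (unit_seq i))\<bar> < \<alpha>"
    and le: "tikhonov K g \<alpha> u \<le> tikhonov K g \<alpha> v"
  shows "supp u \<subseteq> I" and "K u = K v"
proof -
  interpret bounded_linear K by fact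
  define p where "p = (\<lambda>i. inner (K v - g) (K (unit_seq i)))"
  have v0: "coord v i = 0" if "i \<notin> I" for i
    using that v by (auto simp: supp_def)
  have v1: "((\<lambda>i. \<bar>coord v i\<bar>) has_sum (\<Sum>i\<in>I. \<bar>coord v i\<bar>)) UNIV"
    by (rule has_sum_finite_neutralI[where B = I]) (use I v0 in auto)
  define nv where "nv = (\<Sum>i\<in>I. \<bar>coord v i\<bar>)"
  have Tv: "tikhonov K g \<alpha> v = ereal (1 / 2 * (norm (K v - g))\<^sup>2 + \<alpha> * nv)"
    using v1 by (simp add: tikhonov_def l1_norm_def nv_def has_sum_imp_summable infsumI)
  have u1: "(\<lambda>i. \<bar>coord u i\<bar>) summable_on UNIV"
  proof (rule ccontr)
    assume "\<not> ?thesis"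
    then have "tikhonov K g \<alpha> u = \<infinity>"
      using \<alpha> by (simp add: tikhonov_def l1_norm_def)
    then show False using le Tv by simp
  qed
  define nu where "nu = (\<Sum>\<^sub>\<infinity>i. \<bar>coord u i\<bar>)"
  have Tu: "tikhonov K g \<alpha> u = ereal (1 / 2 * (norm (K u - g))\<^sup>2 + \<alpha> * nu)"
    using u1 by (simp add: tikhonov_def l1_norm_def nu_def)
  define d where "d = (\<lambda>i. coord (u - v) i * p i + \<alpha> * (\<bar>coord u i\<bar> - \<bar>coord v i\<bar>))"
  have nu_nv: "((\<lambda>i. \<bar>coord u i\<bar> - \<bar>coord v i\<bar>) has_sum (nu - nv)) UNIV"
    using has_sum_add[OF has_sum_infsum[OF u1] has_sum_uminusI[OF v1]]
    by (simp add: nu_def nv_def)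
  have d_sum: "(d has_sum (inner (K v - g) (K (u - v)) + \<alpha> * (nu - nv))) UNIV"
    unfolding d_def p_def
    by (intro has_sum_add has_sum_inner_operator[OF K] has_sum_cmult_right nu_nv)
  have d_off: "(\<alpha> - \<bar>p i\<bar>) * \<bar>coord u i\<bar> \<le> d i" if "i \<notin> I" for i
  proof -
    have "- (\<bar>p i\<bar> * \<bar>coord u i\<bar>) \<le> coord u i * p i"
      by (metis abs_ge_minus_self abs_mult minus_le_iff mult.commute)
    then show ?thesis using v0[OF that] by (simp add: d_def left_diff_distrib)
  qed
  have d_nonneg: "0 \<le> d i" for i
  proof (cases "i \<in> I")
    case True
    have "p i = - \<alpha> * sgn (coord v i)"
      using on_I[OF True] by (simp add: p_def)
    then have "d i = \<alpha> * (\<bar>coord u i\<bar> - sgn (coord v i) * coord u i)"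
      by (simp add: d_def algebra_simps abs_sgn)
    moreover have "sgn (coord v i) * coord u i \<le> \<bar>coord u i\<bar>"
      by (auto simp: sgn_if)
    ultimately show ?thesis using \<alpha> by simp
  next
    case False
    have "0 \<le> (\<alpha> - \<bar>p i\<bar>) * \<bar>coord u i\<bar>"
      using off_I[OF False] by (simp add: p_def)
    then show ?thesis using d_off[OF False] by linarith
  qed
  have sq: "1 / 2 * (norm (K u - g))\<^sup>2 =
      1 / 2 * (norm (K v - g))\<^sup>2 + inner (K v - g) (K (u - v)) + 1 / 2 * (norm (K u - K v))\<^sup>2"
    by (simp add: diff power2_norm_eq_inner inner_diff_left inner_diff_right inner_commute
        algebra_simps)
  have gap: "1 / 2 * (norm (K u - K v))\<^sup>2 + (inner (K v - g) (K (u - v)) + \<alpha> * (nu - nv)) \<le> 0"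
  proof -
    have "1 / 2 * (norm (K u - g))\<^sup>2 + \<alpha> * nu \<le> 1 / 2 * (norm (K v - g))\<^sup>2 + \<alpha> * nv"
      using le unfolding Tu Tv ereal_less_eq .
    then show ?thesis unfolding sq right_diff_distrib by linarith
  qed
  have d_total: "0 \<le> inner (K v - g) (K (u - v)) + \<alpha> * (nu - nv)"
    by (rule has_sum_nonneg[OF d_sum d_nonneg])
  have "(norm (K u - K v))\<^sup>2 \<le> 0"
    using gap d_total by linarith
  then show "K u = K v" by simp
  have "inner (K v - g) (K (u - v)) + \<alpha> * (nu - nv) \<le> 0"
    using gap zero_le_power2[of "norm (K u - K v)"] by linarith
  then have d0: "d i = 0" for i
    by (rule nonneg_has_sum_le_0D[OF d_sum]) (use d_nonneg in auto)
  have "coord u i = 0" if "i \<notin> I" for i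
    using d_off[OF that] d0[of i] off_I[OF that] by (auto simp: p_def mult_le_0_iff)
  then show "supp u \<subseteq> I" by (auto simp: supp_def)
qed

section \<open>Exact recovery of the support\<close>

text \<open>
  The upper bound on \<open>\<alpha>\<close> keeps the shrinkage \<open>h\<close> below the entries of \<open>u0\<close>, so that no
  element of \<open>I\<close> is lost; the lower bound makes the certificate strict, so that none is added.
\<close>

lemma admissible_minimizer_support:
  assumes K: "bounded_linear K" and I: "finite I" "I \<noteq> {}" and supp: "supp u0 = I"
    and g: "g = K u0 + \<eta>"
    and gap: "0 < min_col K I - COR_in K I - COR_out K I"
    and adm: "admissible_parameter K \<eta> u0 I \<alpha>" and \<alpha>: "0 < \<alpha>"
    and min: "is_arg_min (tikhonov K g \<alpha>) (\<lambda>_. True) u"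
  shows "supp u = I"
proof -
  interpret bounded_linear K by fact
  define M where "M = min_col K I - COR_in K I"
  define b where "b = COR_out K I"
  define s where "s = sup_noise K \<eta>"
  have b: "0 \<le> b" unfolding b_def by (rule COR_out_nonneg[OF K I(1)])
  have M: "0 < M - b" "0 < M" using gap b by (simp_all add: M_def b_def)
  have lower: "(M + b) * s < \<alpha> * (M - b)"
    using adm M(1)
    by (simp add: admissible_parameter_def M_def b_def s_def pos_divide_less_eq)
  have upper: "\<alpha> + s < M * min_entry u0 I"
    using adm by (simp add: admissible_parameter_def M_def s_def)
  have dom: "COR_in K I < min_col K I" using M(2) by (simp add: M_def)
  \<comment> \<open>The optimality conditions on \<open>I\<close> for \<open>u0 + h\<close>, under the assumption that it has the signs
    of \<open>u0\<close>; the assumption is confirmed by \<open>sgn_v\<close> below.\<close>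
  define c where "c = (\<lambda>i. inner \<eta> (K (unit_seq i)) - \<alpha> * sgn (coord u0 i))"
  obtain h where h: "supp h \<subseteq> I" and hc: "\<And>i. i \<in> I \<Longrightarrow> inner (K (unit_seq i)) (K h) = c i"
    using gram_system_solvable[OF K I(1) dom, of c] by blast
  have c_bound: "\<bar>inner (K (unit_seq i)) (K h)\<bar> \<le> \<alpha> + s" if "i \<in> I" for i
  proof -
    have "\<bar>\<alpha> * sgn (coord u0 i)\<bar> \<le> \<alpha>"
      using \<alpha> by (simp add: abs_mult sgn_if)
    then show ?thesis
      using sup_noise_upper[OF K, of \<eta> i] hc[OF that] by (simp add: c_def s_def)
  qed
  have hM: "M * \<bar>coord h i\<bar> \<le> \<alpha> + s" if "i \<in> I" for i
    unfolding M_def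
    by (rule gram_diagonal_dominance[OF K I(1) h _ c_bound that]) (use dom in auto)
  have h_small: "\<bar>coord h i\<bar> < \<bar>coord u0 i\<bar>" if "i \<in> I" for i
  proof -
    have "M * \<bar>coord h i\<bar> < M * min_entry u0 I"
      using hM[OF that] upper by linarith
    then have "\<bar>coord h i\<bar> < min_entry u0 I"
      using M(2) by simp
    also have "\<dots> \<le> \<bar>coord u0 i\<bar>"
      unfolding min_entry_def by (rule Min_le) (use I that in auto)
    finally show ?thesis .
  qed
  define v where "v = u0 + h"
  have v: "supp v \<subseteq> I"
    using h supp by (force simp: v_def supp_def)
  have sgn_v: "sgn (coord v i) = sgn (coord u0 i)" if "i \<in> I" for i
    using h_small[OF that] by (auto simp: v_def sgn_if)
  have nz: "coord v i \<noteq> 0" if "i \<in> I" for i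
    using h_small[OF that] by (auto simp: v_def)
  have res: "inner (K v - g) z = inner z (K h) - inner \<eta> z" for z
    by (simp add: v_def g add inner_diff_left inner_commute[of "K h"])
  have on_I: "inner (K v - g) (K (unit_seq i)) = - \<alpha> * sgn (coord v i)" if "i \<in> I" for i
    using hc[OF that] sgn_v[OF that] by (simp add: res c_def)
  have off_I: "\<bar>inner (K v - g) (K (unit_seq i))\<bar> < \<alpha>" if "i \<notin> I" for i
  proof -
    define G where "G = (\<lambda>j. inner (K (unit_seq i)) (K (unit_seq j)))"
    have G: "(\<Sum>j\<in>I. \<bar>G j\<bar>) \<le> b"
      unfolding G_def b_def by (rule COR_out_upper[OF K that])
    have "M * \<bar>inner (K (unit_seq i)) (K h)\<bar> = M * \<bar>\<Sum>j\<in>I. coord h j * G j\<bar>"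
      using inner_column_finite_support[OF K I(1) h] by (simp add: G_def)
    also have "\<dots> \<le> M * (\<Sum>j\<in>I. \<bar>coord h j * G j\<bar>)"
      using M(2) by (intro mult_left_mono sum_abs) simp
    also have "\<dots> = (\<Sum>j\<in>I. (M * \<bar>coord h j\<bar>) * \<bar>G j\<bar>)"
      by (simp add: sum_distrib_left abs_mult mult.assoc)
    also have "\<dots> \<le> (\<Sum>j\<in>I. (\<alpha> + s) * \<bar>G j\<bar>)"
      by (intro sum_mono mult_right_mono hM) auto
    also have "\<dots> = (\<alpha> + s) * (\<Sum>j\<in>I. \<bar>G j\<bar>)"
      by (simp add: sum_distrib_left)
    also have "\<dots> \<le> (\<alpha> + s) * b"
      using G \<alpha> sup_noise_upper[OF K, of \<eta> 0] by (intro mult_left_mono) (auto simp: s_def)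
    finally have "M * \<bar>inner (K (unit_seq i)) (K h)\<bar> \<le> (\<alpha> + s) * b" .
    moreover have "M * \<bar>inner \<eta> (K (unit_seq i))\<bar> \<le> M * s"
      using sup_noise_upper[OF K, of \<eta> i] M(2) by (intro mult_left_mono) (auto simp: s_def)
    ultimately have "M * (\<bar>inner (K (unit_seq i)) (K h)\<bar> + \<bar>inner \<eta> (K (unit_seq i))\<bar>) < M * \<alpha>"
      using lower by (simp add: algebra_simps)
    then have "\<bar>inner (K (unit_seq i)) (K h)\<bar> + \<bar>inner \<eta> (K (unit_seq i))\<bar> < \<alpha>"
      using M(2) by simp
    then show ?thesis unfolding res by linarith
  qed
  have le: "tikhonov K g \<alpha> u \<le> tikhonov K g \<alpha> v"
    using min by (auto simp: is_arg_min_def not_less)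
  note cert = strict_certificate_determines_minimizers[OF K I(1) v \<alpha> on_I nz off_I le]
  have "u - v = 0"
  proof (rule gram_kernel_trivial[OF K I(1) _ dom])
    show "supp (u - v) \<subseteq> I" using cert(1) v by (force simp: supp_def)
    show "inner (K (unit_seq i)) (K (u - v)) = 0" for i
      using cert(2) by (simp add: diff)
  qed
  then have "u = v" by simp
  then show "supp u = I" using v nz by (auto simp: supp_def)
qed

theorem theorem4p9:
  fixes K :: "ell2 \<Rightarrow> 'h::{real_inner, complete_space}"
    and u0 :: ell2 and I :: "int set" and \<eta> g :: 'h
  assumes "separable_space (euclidean :: 'h topology)"
    and "bounded_linear K" and "onorm K \<le> 1"
    and "FBI K"
    and "u0 \<in> ell0" and "u0 \<noteq> 0" and "supp u0 = I"
    and "g = K u0 + \<eta>"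
    and "COR_in K I + COR_out K I < min_col K I - 2 * noise_to_signal K \<eta> u0 I"
  shows "(\<exists>\<alpha>>0. admissible_parameter K \<eta> u0 I \<alpha>) \<and>
    (\<forall>\<alpha>. admissible_parameter K \<eta> u0 I \<alpha> \<longrightarrow>
      (\<forall>u. is_arg_min (tikhonov K g \<alpha>) (\<lambda>_. True) u \<longrightarrow> supp u = supp u0 \<and> supp u = I))"
proof -
  have I: "finite I" using assms by (auto simp: ell0_def)
  have I_ne: "I \<noteq> {}"
  proof
    assume "I = {}"
    then have "u0 = 0" using assms(7) by (intro ell2_eqI) (auto simp: supp_def)
    then show False using assms(6) by simp
  qed
  define M where "M = min_col K I - COR_in K I"
  define b where "b = COR_out K I"
  define s where "s = sup_noise K \<eta>"
  define w where "w = min_entry u0 I"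
  have s: "0 \<le> s" using sup_noise_upper[OF assms(2), of \<eta> 0] by (simp add: s_def)
  have b: "0 \<le> b" unfolding b_def by (rule COR_out_nonneg[OF assms(2) I])
  have w: "0 < w"
    unfolding w_def min_entry_def using I I_ne assms(7) by (auto simp: supp_def)
  have snr: "2 * (s / w) < M - b"
    using assms(9) by (simp add: M_def b_def s_def w_def noise_to_signal_def)
  have D: "0 < M - b"
    using snr s w by (smt (verit) divide_nonneg_pos)
  have lower_nonneg: "0 \<le> (M + b) / (M - b) * s"
    using D b s by simp
  have adm: "admissible_parameter K \<eta> u0 I \<alpha> \<longleftrightarrow>
      (M + b) / (M - b) * s < \<alpha> \<and> \<alpha> < M * w - s" for \<alpha>
    by (simp add: admissible_parameter_def M_def b_def s_def w_def)
  have "(M + b) / (M - b) * s < M * w - s"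
  proof -
    have "2 * s < (M - b) * w"
      using snr w by (simp add: pos_divide_less_eq)
    then have "M * (2 * s) < M * ((M - b) * w)"
      using D b by (intro mult_strict_left_mono) auto
    then have "(M + b) * s < (M * w - s) * (M - b)"
      by (simp add: algebra_simps)
    then show ?thesis
      using D by (simp add: pos_divide_less_eq)
  qed
  then obtain \<alpha> where "(M + b) / (M - b) * s < \<alpha>" and "\<alpha> < M * w - s"
    using dense by blast
  then have "\<exists>\<alpha>>0. admissible_parameter K \<eta> u0 I \<alpha>"
    using adm lower_nonneg by (intro exI[of _ \<alpha>]) auto
  moreover have "supp u = I"
    if a: "admissible_parameter K \<eta> u0 I \<alpha>"
      and u: "is_arg_min (tikhonov K g \<alpha>) (\<lambda>_. True) u" for \<alpha> u
  proof -
    have "0 < \<alpha>" using a adm lower_nonneg by (meson le_less_trans)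
    then show ?thesis
      using D by (intro admissible_minimizer_support[OF assms(2) I I_ne assms(7,8) _ a _ u])
        (simp_all add: M_def b_def)
  qed
  ultimately show ?thesis using assms(7) by blast
qed

end
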